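(* Let $G$ and $H$ be connected graphs. Then $$2b(G^2)-2 \leq b_{\rm g}(G \circ H) \leq 2b(G^2),$$ where equality in the lower bound requires $H = K_1$ (that is, if $H\neq K_1$ then $b_{\rm g}(G\circ H)\neq 2b(G^2)-2$). Additionally, $$2b(G^2)-3 \leq b_{\rm g}'(G \circ H) \leq 2b(G^2)+1,$$ where once again, if $H \neq K_1$, equality in the lower bound cannot hold.
   Context: All graphs are finite, simple and undirected; connected graphs are nonempty. The burning game on a graph $G$ is played by two players, Burner and Staller, in rounds $t=1,2,3,\dots$. Initially (round $0$) all vertices are unburned. Each round $t\ge 1$ consists of two phases: first, in the spreading phase, every unburned vertex having a burning neighbor starts to burn (fire spreads simultaneously, by distance one, from all burning vertices); then, in the selection phase, if unburned vertices remain, the player whose turn it is chooses one unburned vertex, which starts to burn. Burning vertices stay burning forever. The players alternate: one of them selects in the odd rounds, the other in the even rounds. The game ends in the first round in which all vertices of $G$ are burning (possibly already after the spreading phase of that round). Burner wants to minimize the number of rounds and Staller wants to maximize it. If both play optimally, the number of rounds is denoted $b_{\rm g}(G)$ when Burner makes the first move (selects in round 1), and $b_{\rm g}'(G)$ when Staller makes the first move. The burning number $b(G)$ is the minimum number of rounds needed to burn all vertices of $G$ in the same process when a single agent makes all selections (one vertex per round). The square $G^2$ of $G$ has vertex set $V(G)$, with distinct $u,v$ adjacent iff $d_G(u,v)\le 2$. The corona product $G\circ H$ is obtained from one copy of $G$ and $|V(G)|$ disjoint copies of $H$ by joining the $i$-th vertex of $G$ to every vertex in the $i$-th copy of $H$.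 $K_1$ is the one-vertex graph, and $H=K_1$ is meant up to isomorphism. *)

theory Defs
  imports "Graph_Theory.Graph_Theory"
begin

text \<open>
  Finite simple undirected graphs are \<^locale>\<open>pair_graph\<close>s, every edge being represented by
  its two arcs; \<^const>\<open>connected\<close> includes nonemptiness of the vertex set.
\<close>

abbreviation graph_dist :: "'a pair_pre_digraph \<Rightarrow> 'a \<Rightarrow> 'a \<Rightarrow> ereal" where
  "graph_dist G \<equiv> wf_digraph.\<mu> (with_proj G) (\<lambda>_. 1)"

definition square :: "'a pair_pre_digraph \<Rightarrow> 'a pair_pre_digraph" where
  "square G = \<lparr> pverts = pverts G,
     parcs = {(u, v). u \<in> pverts G \<and> v \<in> pverts G \<and> u \<noteq> v \<and> graph_dist G u v \<le> 2} \<rparr>"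

text \<open>\<open>Inr (u, x)\<close> is the vertex \<open>x\<close> of the copy of \<open>H\<close> attached to the vertex \<open>u\<close> of \<open>G\<close>.\<close>

definition corona ::
  "'a pair_pre_digraph \<Rightarrow> 'b pair_pre_digraph \<Rightarrow> ('a + 'a \<times> 'b) pair_pre_digraph" where
  "corona G H = \<lparr> pverts = Inl ` pverts G \<union> Inr ` (pverts G \<times> pverts H),
     parcs = {(Inl u, Inl v) | u v. (u, v) \<in> parcs G}
       \<union> {(Inr (u, x), Inr (u, y)) | u x y. u \<in> pverts G \<and> (x, y) \<in> parcs H}
       \<union> {(Inl u, Inr (u, x)) | u x. u \<in> pverts G \<and> x \<in> pverts H}
       \<union> {(Inr (u, x), Inl u) | u x. u \<in> pverts G \<and> x \<in> pverts H} \<rparr>"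

definition spread :: "'a pair_pre_digraph \<Rightarrow> 'a set \<Rightarrow> 'a set" where
  "spread G B = B \<union> {v \<in> pverts G. \<exists>u \<in> B. (u, v) \<in> parcs G}"

text \<open>The possible sets of burning vertices after one round (spreading, then selection)
  that starts with \<open>B\<close> burning.\<close>

definition round_outcomes :: "'a pair_pre_digraph \<Rightarrow> 'a set \<Rightarrow> 'a set set" where
  "round_outcomes G B =
    (if pverts G \<subseteq> spread G B then {spread G B}
     else {insert v (spread G B) | v. v \<in> pverts G - spread G B})"

text \<open>\<^const>\<open>round_outcomes\<close> is stationary once all vertices burn, so the least number of
  iterations reaching \<^term>\<open>pverts G\<close> is the least number of rounds of the one-player process.\<close>

definition burning_number :: "'a pair_pre_digraph \<Rightarrow> nat" where
  "burning_number G =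
    (LEAST n. ({}, pverts G) \<in> {(B, B'). B' \<in> round_outcomes G B} ^^ n)"

lemma finite_round_outcomes: "finite (pverts G) \<Longrightarrow> finite (round_outcomes G B)"
  by (simp add: round_outcomes_def setcompr_eq_image)

lemma round_outcomes_nonempty: "round_outcomes G B \<noteq> {}"
  by (auto simp: round_outcomes_def)

lemma round_outcomes_subset:
  "B \<subseteq> pverts G \<Longrightarrow> B' \<in> round_outcomes G B \<Longrightarrow> B' \<subseteq> pverts G"
  by (auto simp: round_outcomes_def spread_def split: if_splits)

lemma round_outcomes_progress:
  assumes "\<not> pverts G \<subseteq> B" "B' \<in> round_outcomes G B"
  shows "pverts G - B' \<subset> pverts G - B"
  using assms by (auto simp: round_outcomes_def spread_def split: if_splits)

lemma burning_number_attained: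
  assumes "finite (pverts G)"
  shows "({}, pverts G) \<in> {(B, B'). B' \<in> round_outcomes G B} ^^ burning_number G"
proof -
  have "\<exists>n. (B, pverts G) \<in> {(B, B'). B' \<in> round_outcomes G B} ^^ n" if "B \<subseteq> pverts G" for B
    using that
  proof (induction "card (pverts G - B)" arbitrary: B rule: less_induct)
    case less
    show ?case
    proof (cases "pverts G \<subseteq> B")
      case True
      with less.prems have "(B, pverts G) \<in> {(B, B'). B' \<in> round_outcomes G B} ^^ 0" by simp
      then show ?thesis by blast
    next
      case False
      obtain B' where B': "B' \<in> round_outcomes G B"
        using round_outcomes_nonempty by blast
      with False have "card (pverts G - B') < card (pverts G - B)"
        using assms by (intro psubset_card_mono round_outcomes_progress) auto
      then obtain n where n: "(B', pverts G) \<in> {(B, B'). B' \<in> round_outcomes G B} ^^ n"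
        using less.hyps round_outcomes_subset[OF less.prems B'] by metis
      have "(B, pverts G) \<in> {(B, B'). B' \<in> round_outcomes G B} ^^ Suc n"
        by (rule relpow_Suc_I2[OF _ n]) (simp add: B')
      then show ?thesis by blast
    qed
  qed
  then show ?thesis
    unfolding burning_number_def by (metis (no_types, lifting) LeastI_ex empty_subsetI)
qed

datatype player = Burner | Staller

fun opponent :: "player \<Rightarrow> player" where
  "opponent Burner = Staller"
| "opponent Staller = Burner"

fun optimum :: "player \<Rightarrow> nat set \<Rightarrow> nat" where
  "optimum Burner = Min"
| "optimum Staller = Max"

text \<open>The number of rounds still to be played under optimal play when \<open>B\<close> is burning and \<open>p\<close>
  has the selection in the next round. The finiteness guard only makes the function total.\<close>

function rounds_left :: "'a pair_pre_digraph \<Rightarrow> player \<Rightarrow> 'a set \<Rightarrow> nat" where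
  "rounds_left G p B =
    (if infinite (pverts G) \<or> pverts G \<subseteq> B then 0
     else 1 + optimum p (rounds_left G (opponent p) ` round_outcomes G B))"
  by pat_completeness auto
termination
  by (relation "measure (\<lambda>(G, p, B). card (pverts G - B))")
     (auto simp del: psubset_eq simp: psubset_card_mono round_outcomes_progress)

declare rounds_left.simps [simp del]

definition burning_game_number :: "'a pair_pre_digraph \<Rightarrow> nat" where
  "burning_game_number G = rounds_left G Burner {}"

definition burning_game_number_Staller :: "'a pair_pre_digraph \<Rightarrow> nat" where
  "burning_game_number_Staller G = rounds_left G Staller {}"

lemma pair_graph_iff:
  "pair_graph G \<longleftrightarrow> finite (pverts G) \<and> parcs G \<subseteq> pverts G \<times> pverts G
     \<and> sym (parcs G) \<and> irrefl (parcs G)"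
proof
  assume "pair_graph G"
  then interpret pair_graph G .
  show "finite (pverts G) \<and> parcs G \<subseteq> pverts G \<times> pverts G
     \<and> sym (parcs G) \<and> irrefl (parcs G)"
    using pair_finite_verts pair_sym_arcs pair_no_loops wellformed'
    by (fastforce simp: symmetric_def irrefl_def)
next
  assume *: "finite (pverts G) \<and> parcs G \<subseteq> pverts G \<times> pverts G
     \<and> sym (parcs G) \<and> irrefl (parcs G)"
  then have "finite (parcs G)"
    by (meson finite_SigmaI finite_subset)
  with * show "pair_graph G"
    by unfold_locales (auto simp: symmetric_def irrefl_def)
qed

lemma graph_dist_le_2_iff:
  assumes "pair_graph G" and "u \<in> pverts G" "v \<in> pverts G" "u \<noteq> v"
  shows "graph_dist G u v \<le> 2 \<longleftrightarrow>
    (u, v) \<in> parcs G \<or> (\<exists>w. (u, w) \<in> parcs G \<and> (w, v) \<in> parcs G)"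
proof -
  interpret pair_graph G by fact
  have cost: "awalk_cost (\<lambda>_. 1) p = real (length p)" for p :: "('a \<times> 'a) list"
    by (induct p) auto
  show ?thesis
  proof
    assume le: "graph_dist G u v \<le> 2"
    have "\<exists>p. awalk u p v \<and> length p \<le> 2"
    proof (rule ccontr)
      assume "\<not> ?thesis"
      then have "(3::ereal) \<le> ereal (awalk_cost (\<lambda>_. 1) p)" if "awalk u p v" for p
        using that by (auto simp: cost not_le)
      then have "3 \<le> graph_dist G u v"
        unfolding \<mu>_def by (auto intro!: INF_greatest)
      with le have "(3::ereal) \<le> 2" by (rule order_trans[rotated])
      then show False by simp
    qed
    then obtain p where p: "awalk u p v" "length p \<le> 2" by blast
    show "(u, v) \<in> parcs G \<or> (\<exists>w. (u, w) \<in> parcs G \<and> (w, v) \<in> parcs G)"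
    proof (cases p)
      case Nil
      with p assms(4) show ?thesis by (auto simp: awalk_Nil_iff)
    next
      case (Cons e es)
      with p show ?thesis
        by (cases es) (auto simp: awalk_Cons_iff awalk_Nil_iff)
    qed
  next
    assume "(u, v) \<in> parcs G \<or> (\<exists>w. (u, w) \<in> parcs G \<and> (w, v) \<in> parcs G)"
    then obtain p where p: "awalk u p v" "length p \<le> 2"
    proof (elim disjE exE)
      assume "(u, v) \<in> parcs G"
      then show ?thesis
        using assms by (intro that[of "[(u, v)]"]) (auto simp: awalk_Cons_iff awalk_Nil_iff)
    next
      fix w assume "(u, w) \<in> parcs G \<and> (w, v) \<in> parcs G"
      then show ?thesis
        using assms
        by (intro that[of "[(u, w), (w, v)]"]) (auto simp: awalk_Cons_iff awalk_Nil_iff dest: wellformed')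
    qed
    have "graph_dist G u v \<le> awalk_cost (\<lambda>_. 1) p"
      using p(1) by (rule min_cost_le_walk_cost)
    also have "\<dots> \<le> 2" using p(2) by (simp add: cost)
    finally show "graph_dist G u v \<le> 2" .
  qed
qed

lemma pair_graph_square:
  assumes "pair_graph G"
  shows "pair_graph (square G)"
proof -
  have G: "finite (pverts G)" "sym (parcs G)"
    using assms by (auto simp: pair_graph_iff)
  have "sym (parcs (square G))"
  proof (rule symI)
    fix u v assume "(u, v) \<in> parcs (square G)"
    then have uv: "u \<in> pverts G" "v \<in> pverts G" "u \<noteq> v" "graph_dist G u v \<le> 2"
      by (simp_all add: square_def)
    then have "(u, v) \<in> parcs G \<or> (\<exists>w. (u, w) \<in> parcs G \<and> (w, v) \<in> parcs G)"
      using graph_dist_le_2_iff[OF assms] by blast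
    then have "(v, u) \<in> parcs G \<or> (\<exists>w. (v, w) \<in> parcs G \<and> (w, u) \<in> parcs G)"
      using G(2) by (blast dest: symD)
    then have "graph_dist G v u \<le> 2"
      using graph_dist_le_2_iff[OF assms uv(2,1)] uv(3) by blast
    with uv show "(v, u) \<in> parcs (square G)"
      by (simp add: square_def)
  qed
  moreover have "irrefl (parcs (square G))" "parcs (square G) \<subseteq> pverts (square G) \<times> pverts (square G)"
    by (auto simp: square_def irrefl_def)
  ultimately show ?thesis
    using G(1) by (simp add: pair_graph_iff square_def)
qed

lemma pair_graph_corona:
  assumes "pair_graph G" "pair_graph H"
  shows "pair_graph (corona G H)"
  using assms
  by (auto simp: pair_graph_iff corona_def irrefl_def sym_def)

end

theory Submission
  imports Defs
begin

text \<open>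
  Two rounds of fire spreading in the core \<open>G\<close> of the corona are one round of spreading in the
  square of \<open>G\<close>. For the upper bounds, Burner plays an optimal burning sequence of the square on
  the core; the leaves burn one round after the core. For the lower bounds, Staller always selects
  a leaf over a core vertex that is about to burn anyway, so that only Burner's selections,
  projected to the core, matter, and they yield a burning sequence of the square. If \<open>H\<close> has two
  vertices, then Staller's last selection cannot burn all leaves over an unburned core vertex,
  which saves one round.
\<close>

section \<open>Spreading and the one-player process\<close>

lemma spread_mono: "B \<subseteq> B' \<Longrightarrow> spread G B \<subseteq> spread G B'"
  by (auto simp: spread_def)

lemma subset_spread: "B \<subseteq> spread G B"
  by (auto simp: spread_def)

lemma spread_subset: "B \<subseteq> pverts G \<Longrightarrow> spread G B \<subseteq> pverts G"
  by (auto simp: spread_def)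

lemma spread_empty [simp]: "spread G {} = {}"
  by (simp add: spread_def)

lemma pverts_square [simp]: "pverts (square G) = pverts G"
  by (simp add: square_def)

text \<open>Distance at most 2 means a path of one or two arcs. Paths of a single arc are covered
  because \<open>spread\<close> keeps what burns already.\<close>

lemma spread_square:
  assumes "pair_graph G" "D \<subseteq> pverts G"
  shows "spread (square G) D = spread G (spread G D)"
proof -
  have arcs: "u \<in> pverts G \<and> v \<in> pverts G" if "(u, v) \<in> parcs G" for u v
    using assms(1) that by (auto simp: pair_graph_iff)
  have "v \<in> spread (square G) D \<longleftrightarrow> v \<in> spread G (spread G D)" for v
  proof
    assume "v \<in> spread (square G) D"
    then consider "v \<in> D" | u where "u \<in> D" "u \<in> pverts G" "v \<in> pverts G" "u \<noteq> v" "graph_dist G u v \<le> 2"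
      by (auto simp: spread_def square_def)
    then show "v \<in> spread G (spread G D)"
    proof cases
      case 1
      then show ?thesis by (simp add: spread_def)
    next
      case (2 u)
      then show ?thesis
        using graph_dist_le_2_iff[OF assms(1) 2(2-4)] arcs by (auto simp: spread_def)
    qed
  next
    assume v: "v \<in> spread G (spread G D)"
    show "v \<in> spread (square G) D"
    proof (cases "v \<in> D")
      case True
      then show ?thesis by (simp add: spread_def)
    next
      case False
      with v obtain u where u: "u \<in> D" "(u, v) \<in> parcs G \<or> (\<exists>w. (u, w) \<in> parcs G \<and> (w, v) \<in> parcs G)"
        by (auto simp: spread_def)
      then have "v \<in> pverts G" "u \<noteq> v" "u \<in> pverts G"
        using arcs False by auto
      with u show ?thesis
        using graph_dist_le_2_iff[OF assms(1), of u v] by (auto simp: spread_def square_def)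
    qed
  qed
  then show ?thesis by blast
qed

text \<open>Closure carries membership along walks, and symmetry of the arcs makes every vertex
  reachable from any point of \<open>D\<close>. Staller needs this to find core vertices just
  outside a spread.\<close>

lemma connected_spread_closed:
  assumes "pair_graph G" "connected (with_proj G)"
    and "spread G D \<subseteq> D" "D \<subseteq> pverts G" "D \<noteq> {}"
  shows "D = pverts G"
proof -
  interpret pair_graph G by fact
  have sc: "strongly_connected (with_proj G)"
    using assms(2) sym_arcs by (rule symmetric_connected_imp_strongly_connected[rotated])
  obtain u where u: "u \<in> D" using assms(5) by blast
  have "v \<in> D" if "v \<in> pverts G" for v
  proof -
    have "u \<rightarrow>\<^sup>*\<^bsub>with_proj G\<^esub> v"
      using sc u that assms(4) by (auto simp: strongly_connected_def)
    then show ?thesis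
    proof (induction rule: reachable_induct)
      case base
      show ?case by (rule u)
    next
      case (step x y)
      then show ?case using assms(3) by (auto simp: spread_def dest: wellformed')
    qed
  qed
  with assms(4) show ?thesis by blast
qed

text \<open>Unlike \<^const>\<open>round_outcomes\<close>, this allows the selection of a burning vertex, which makes
  it monotone in both arguments.\<close>

fun burnable :: "'a pair_pre_digraph \<Rightarrow> nat \<Rightarrow> 'a set \<Rightarrow> bool" where
  "burnable G 0 D \<longleftrightarrow> pverts G \<subseteq> D"
| "burnable G (Suc n) D \<longleftrightarrow> (\<exists>v\<in>pverts G. burnable G n (insert v (spread G D)))"

lemma burnable_mono_set: "burnable G n D \<Longrightarrow> D \<subseteq> D' \<Longrightarrow> burnable G n D'"
proof (induction n arbitrary: D D')
  case 0
  then show ?case by auto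
next
  case (Suc n)
  then obtain v where "v \<in> pverts G" "burnable G n (insert v (spread G D))" by auto
  moreover have "insert v (spread G D) \<subseteq> insert v (spread G D')"
    using spread_mono[OF Suc.prems(2)] by blast
  ultimately show ?case by (auto intro: Suc.IH)
qed

lemma burnable_Suc:
  assumes "burnable G n D" "pverts G \<noteq> {}"
  shows "burnable G (Suc n) D"
proof -
  obtain v where "v \<in> pverts G" using assms(2) by blast
  moreover have "burnable G n (insert v (spread G D))"
    using assms(1) by (rule burnable_mono_set) (use subset_spread[of D G] in blast)
  ultimately show ?thesis by auto
qed

lemma burnable_mono:
  assumes "burnable G m D" "m \<le> n" "pverts G \<noteq> {}"
  shows "burnable G n D"
  using assms(2,1) by (induction rule: dec_induct) (simp_all add: burnable_Suc assms(3) del: burnable.simps)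

text \<open>Turns an idle selection into a legal one: if \<open>v\<close> already burns after
  spreading, some unburned vertex is taken instead, which can only enlarge the burning set.\<close>

lemma round_outcomes_superset:
  assumes "B \<subseteq> pverts G" "v \<in> pverts G"
  shows "\<exists>B' \<in> round_outcomes G B. insert v (spread G B) \<subseteq> B'"
proof (cases "pverts G \<subseteq> spread G B")
  case True
  then show ?thesis using assms by (auto simp: round_outcomes_def)
next
  case False
  then obtain w where w: "w \<in> pverts G - spread G B" "v \<in> spread G B \<or> w = v"
    using assms(2) by blast
  then have "insert w (spread G B) \<in> round_outcomes G B"
    using False by (auto simp: round_outcomes_def)
  then show ?thesis using w(2) by blast
qed

lemma burnable_imp_relpow:
  assumes "burnable G n D" "D \<subseteq> pverts G"
  shows "(D, pverts G) \<in> {(B, B'). B' \<in> round_outcomes G B} ^^ n"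
  using assms
proof (induction n arbitrary: D)
  case 0
  then show ?case by auto
next
  case (Suc n)
  then obtain v where v: "v \<in> pverts G" "burnable G n (insert v (spread G D))" by auto
  obtain D' where D': "D' \<in> round_outcomes G D" "insert v (spread G D) \<subseteq> D'"
    using round_outcomes_superset[OF Suc.prems(2) v(1)] by blast
  have "(D', pverts G) \<in> {(B, B'). B' \<in> round_outcomes G B} ^^ n"
    by (rule Suc.IH[OF burnable_mono_set[OF v(2) D'(2)] round_outcomes_subset[OF Suc.prems(2) D'(1)]])
  then show ?case
    by (rule relpow_Suc_I2[rotated]) (simp add: D'(1))
qed

lemma relpow_imp_burnable:
  assumes "(D, pverts G) \<in> {(B, B'). B' \<in> round_outcomes G B} ^^ n" "pverts G \<noteq> {}"
  shows "burnable G n D"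
  using assms(1)
proof (induction n arbitrary: D)
  case 0
  then show ?case by simp
next
  case (Suc n)
  obtain D' where D': "D' \<in> round_outcomes G D"
    and "(D', pverts G) \<in> {(B, B'). B' \<in> round_outcomes G B} ^^ n"
    using relpow_Suc_D2[OF Suc.prems] by blast
  then have "burnable G n D'" by (blast intro: Suc.IH)
  \<comment> \<open>If spreading alone burns everything, nothing is selected and an arbitrary vertex
    fills the slot; this is where nonemptiness enters.\<close>
  moreover obtain v where "v \<in> pverts G" "D' \<subseteq> insert v (spread G D)"
    using D' assms(2) by (auto simp: round_outcomes_def split: if_splits)
  ultimately show ?case by (auto intro: burnable_mono_set)
qed

lemma burnable_burning_number:
  "finite (pverts G) \<Longrightarrow> pverts G \<noteq> {} \<Longrightarrow> burnable G (burning_number G) {}"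
  by (intro relpow_imp_burnable burning_number_attained)

lemma burning_number_le: "burnable G n {} \<Longrightarrow> burning_number G \<le> n"
  unfolding burning_number_def by (rule Least_le) (simp add: burnable_imp_relpow)

section \<open>The value of the game\<close>

lemma rounds_left_burnt: "pverts G \<subseteq> B \<Longrightarrow> rounds_left G p B = 0"
  by (subst rounds_left.simps) simp

lemma rounds_left_Burner_le:
  assumes "finite (pverts G)" "B' \<in> round_outcomes G B"
  shows "rounds_left G Burner B \<le> Suc (rounds_left G Staller B')"
  using assms by (subst rounds_left.simps) (auto intro!: Min_le simp: finite_round_outcomes)

lemma rounds_left_Burner_attained:
  assumes "finite (pverts G)" "\<not> pverts G \<subseteq> B"
  obtains B' where "B' \<in> round_outcomes G B"
    "rounds_left G Burner B = Suc (rounds_left G Staller B')"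
proof -
  have "Min (rounds_left G Staller ` round_outcomes G B) \<in> rounds_left G Staller ` round_outcomes G B"
    using assms(1) by (intro Min_in) (simp_all add: finite_round_outcomes round_outcomes_nonempty)
  moreover have "rounds_left G Burner B = Suc (Min (rounds_left G Staller ` round_outcomes G B))"
    using assms by (subst rounds_left.simps) simp
  ultimately show ?thesis using that by auto
qed

lemma rounds_left_Staller_ge:
  assumes "finite (pverts G)" "\<not> pverts G \<subseteq> B" "B' \<in> round_outcomes G B"
  shows "Suc (rounds_left G Burner B') \<le> rounds_left G Staller B"
  using assms
  by (subst (2) rounds_left.simps) (auto intro!: Max_ge simp: finite_round_outcomes)

lemma rounds_left_Staller_le:
  assumes "finite (pverts G)" "\<And>B'. B' \<in> round_outcomes G B \<Longrightarrow> rounds_left G Burner B' \<le> n"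
  shows "rounds_left G Staller B \<le> Suc n"
  using assms
  by (subst rounds_left.simps) (auto simp: finite_round_outcomes round_outcomes_nonempty)

section \<open>The corona\<close>

definition base :: "'a + 'a \<times> 'b \<Rightarrow> 'a" where
  "base = case_sum id fst"

lemma base_simps [simp]: "base (Inl u) = u" "base (Inr (u, x)) = u"
  by (simp_all add: base_def)

lemma pverts_corona [simp]:
  "Inl u \<in> pverts (corona G H) \<longleftrightarrow> u \<in> pverts G"
  "Inr (u, x) \<in> pverts (corona G H) \<longleftrightarrow> u \<in> pverts G \<and> x \<in> pverts H"
  by (auto simp: corona_def)

lemma Inl_in_spread_corona:
  "Inl u \<in> spread (corona G H) B \<longleftrightarrow>
    u \<in> spread G (Inl -` B) \<or> (u \<in> pverts G \<and> (\<exists>x\<in>pverts H. Inr (u, x) \<in> B))"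
  by (auto simp: spread_def corona_def)

lemma Inr_in_spread_corona:
  "Inr (u, x) \<in> spread (corona G H) B \<longleftrightarrow> Inr (u, x) \<in> B \<or>
    (u \<in> pverts G \<and> x \<in> pverts H \<and> (Inl u \<in> B \<or> (\<exists>y. (y, x) \<in> parcs H \<and> Inr (u, y) \<in> B)))"
  by (auto simp: spread_def corona_def)

lemma base_image_subset_iff:
  "base ` B \<subseteq> D \<longleftrightarrow> (\<forall>u. Inl u \<in> B \<longrightarrow> u \<in> D) \<and> (\<forall>u x. Inr (u, x) \<in> B \<longrightarrow> u \<in> D)"
proof
  assume *: "base ` B \<subseteq> D"
  show "(\<forall>u. Inl u \<in> B \<longrightarrow> u \<in> D) \<and> (\<forall>u x. Inr (u, x) \<in> B \<longrightarrow> u \<in> D)"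
    using * by (force simp: image_subset_iff)
next
  assume *: "(\<forall>u. Inl u \<in> B \<longrightarrow> u \<in> D) \<and> (\<forall>u x. Inr (u, x) \<in> B \<longrightarrow> u \<in> D)"
  show "base ` B \<subseteq> D"
  proof (intro image_subsetI)
    fix z assume "z \<in> B"
    then show "base z \<in> D" using * by (cases z) auto
  qed
qed

locale corona_game =
  fixes G :: "'a pair_pre_digraph" and H :: "'b pair_pre_digraph"
  assumes G: "pair_graph G" "connected (with_proj G)"
    and H: "pair_graph H" "connected (with_proj H)"
begin

abbreviation C where "C \<equiv> corona G H"

lemma finite_C: "finite (pverts C)"
  using pair_graph_corona[OF G(1) H(1)] by (simp add: pair_graph_iff)

lemma nonempty: "pverts G \<noteq> {}" "pverts H \<noteq> {}"
  using G(2) H(2) by (auto simp: connected_def strongly_connected_def)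

subsection \<open>Upper bounds\<close>

text \<open>Invariant when Burner is to select: \<open>D\<close> burns in the square process, the
  core is one \<open>G\<close>-spread ahead of it, and all leaves over \<open>D\<close> burn. Burner
  copies the selections of the square, and Staller's choices only add fire.\<close>

lemma rounds_left_Burner_upper:
  assumes "burnable (square G) n D" "D \<subseteq> pverts G" "B \<subseteq> pverts C"
    and "spread G D \<subseteq> Inl -` B" "D \<times> pverts H \<subseteq> Inr -` B"
  shows "rounds_left C Burner B \<le> 2 * n"
  using assms
proof (induction n arbitrary: D B)
  case 0
  then have "D = pverts G" by simp
  then have "pverts C \<subseteq> B"
    using 0 subset_spread[of D G] by (auto simp: corona_def)
  then show ?case by (simp add: rounds_left_burnt)
next
  case (Suc n)
  obtain v where v: "v \<in> pverts G" "burnable (square G) n (insert v (spread (square G) D))"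
    using Suc.prems(1) by auto
  let ?D = "insert v (spread (square G) D)"
  have D: "?D \<subseteq> pverts G"
    using v(1) Suc.prems(2) spread_subset[of D "square G"] by auto
  obtain B' where B': "B' \<in> round_outcomes C B" "insert (Inl v) (spread C B) \<subseteq> B'"
    using round_outcomes_superset[OF Suc.prems(3), of "Inl v"] v(1) by auto
  have B'C: "B' \<subseteq> pverts C"
    using round_outcomes_subset[OF Suc.prems(3) B'(1)] .
  \<comment> \<open>The core's lead of one \<open>G\<close>-spread and the spread of this round
    together make one spread in the square.\<close>
  have "spread G (spread G D) \<subseteq> Inl -` B'"
    using B'(2) spread_mono[OF Suc.prems(4), of G]
    by (auto simp: Inl_in_spread_corona subset_iff)
  then have DB': "?D \<subseteq> Inl -` B'"
    using B'(2) by (simp add: spread_square[OF G(1) Suc.prems(2)])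
  have "rounds_left C Burner B'' \<le> 2 * n" if "B'' \<in> round_outcomes C B'" for B''
  proof (rule Suc.IH[OF v(2) D])
    have sub: "spread C B' \<subseteq> B''"
      using that by (auto simp: round_outcomes_def split: if_splits)
    show "B'' \<subseteq> pverts C" by (rule round_outcomes_subset[OF B'C that])
    show "spread G ?D \<subseteq> Inl -` B''"
      using sub spread_mono[OF DB', of G] by (auto simp: Inl_in_spread_corona subset_iff)
    \<comment> \<open>The vertices of \<open>?D\<close> burn in the core since Burner's round, so
      the spread of Staller's round reaches all leaves over them.\<close>
    show "?D \<times> pverts H \<subseteq> Inr -` B''"
    proof -
      have "Inr (u, x) \<in> spread C B'" if "u \<in> ?D" "x \<in> pverts H" for u x
        using that DB' D by (auto simp: Inr_in_spread_corona)
      with sub show ?thesis by blast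
    qed
  qed
  then have "rounds_left C Staller B' \<le> Suc (2 * n)"
    by (rule rounds_left_Staller_le[OF finite_C])
  then show ?case
    using rounds_left_Burner_le[OF finite_C B'(1)] by simp
qed

lemma burnable_square: "burnable (square G) (burning_number (square G)) {}"
  using burnable_burning_number[of "square G"] G(1) nonempty by (simp add: pair_graph_iff)

lemma burning_game_number_upper: "burning_game_number C \<le> 2 * burning_number (square G)"
  unfolding burning_game_number_def
  by (rule rounds_left_Burner_upper[OF burnable_square]) simp_all

lemma burning_game_number_Staller_upper:
  "burning_game_number_Staller C \<le> 2 * burning_number (square G) + 1"
proof -
  \<comment> \<open>For empty \<open>D\<close> the invariant demands nothing of the burning set, so
    any opening of Staller is admissible.\<close>
  have "rounds_left C Burner B \<le> 2 * burning_number (square G)"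
    if "B \<in> round_outcomes C {}" for B
    using round_outcomes_subset[OF _ that]
    by (intro rounds_left_Burner_upper[OF burnable_square]) simp_all
  then show ?thesis
    unfolding burning_game_number_Staller_def
    using rounds_left_Staller_le[OF finite_C] by fastforce
qed

subsection \<open>Lower bounds\<close>

text \<open>In the positions \<open>B\<close> where Burner is to select, \<open>D\<close> stands for the vertices of the square
  burning after Burner's previous selection. The core burns at most on the \<open>G\<close>-spread of \<open>D\<close>, but
  Staller may have selected leaves over vertices which the fire reaches one round later. The
  condition on unburned leaves is available only if \<open>H\<close> has two vertices; \<open>k = 0\<close> encodes this
  case and \<open>k = 1\<close> the general one.\<close>

definition dominated :: "nat \<Rightarrow> ('a + 'a \<times> 'b) set \<Rightarrow> 'a set \<Rightarrow> bool" where
  "dominated k B D \<longleftrightarrow> Inl -` B \<subseteq> spread G D \<and> base ` B \<subseteq> spread G (spread G D) \<and>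
    (k = 0 \<longrightarrow> (\<forall>u\<in>pverts G - D. \<exists>x\<in>pverts H. Inr (u, x) \<notin> B))"

text \<open>Leaves ignite only from their core vertex or within their own copy, and the core
  advances by one \<open>G\<close>-spread. So all fire stays over one square spread of
  \<open>D\<close>, and only Burner's selection can lie outside.\<close>

lemma dominated_Burner:
  assumes "dominated k B D" "D \<subseteq> pverts G" "B' \<in> round_outcomes C B"
  shows "\<exists>v\<in>pverts G. base ` B' \<subseteq> insert v (spread (square G) D)"
proof -
  have eq: "spread (square G) D = spread G (spread G D)"
    by (rule spread_square[OF G(1) assms(2)])
  have core: "Inl -` B \<subseteq> spread G D"
    and all: "base ` B \<subseteq> spread G (spread G D)"
    using assms(1) by (auto simp: dominated_def)
  have sub: "base ` spread C B \<subseteq> spread (square G) D"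
    using all core spread_mono[OF core, of G] subset_spread[of "spread G D" G]
    unfolding eq base_image_subset_iff Inl_in_spread_corona Inr_in_spread_corona by blast
  show ?thesis
  proof (cases "pverts C \<subseteq> spread C B")
    case True
    then have "base ` B' \<subseteq> spread (square G) D"
      using sub assms(3) by (simp add: round_outcomes_def)
    with nonempty(1) show ?thesis by blast
  next
    case False
    then obtain z where z: "z \<in> pverts C" "B' = insert z (spread C B)"
      using assms(3) by (auto simp: round_outcomes_def)
    then have "base z \<in> pverts G" by (auto simp: corona_def)
    with z(2) sub show ?thesis by auto
  qed
qed

text \<open>Staller wastes the move on a leaf over a vertex that the second \<open>G\<close>-spread
  of \<open>D\<close> reaches anyway. If the first spread is already the whole core, every selection
  is harmless.\<close>

lemma dominated_Staller:
  assumes "base ` B \<subseteq> D" "D \<subseteq> pverts G" "D \<noteq> {}"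
    and two: "k = 0 \<Longrightarrow> \<exists>x\<in>pverts H. \<exists>y\<in>pverts H. x \<noteq> y"
  shows "\<exists>B'\<in>round_outcomes C B. dominated k B' D"
proof -
  have B: "Inl -` B \<subseteq> D" "\<And>u x. Inr (u, x) \<in> B \<Longrightarrow> u \<in> D"
    using assms(1) by (auto simp: base_image_subset_iff)
  have core: "Inl -` spread C B \<subseteq> spread G D"
    using B(2) spread_mono[OF B(1), of G] subset_spread[of D G]
    unfolding subset_iff vimage_eq Inl_in_spread_corona by blast
  have leaves: "u \<in> D" if "Inr (u, x) \<in> spread C B" for u x
    using that B by (auto simp: Inr_in_spread_corona)
  have DV: "spread G D \<subseteq> pverts G" by (rule spread_subset[OF assms(2)])
  have sub: "base ` spread C B \<subseteq> spread G (spread G D)"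
    using core leaves subset_spread[of D G] subset_spread[of "spread G D" G]
    unfolding base_image_subset_iff by blast
  \<comment> \<open>Criterion for a harmless selection \<open>z\<close>. Outside \<open>D\<close> no
    leaf burns before it, and a single selection cannot fill a copy of \<open>H\<close> with two
    vertices, which gives the clause for \<open>k = 0\<close>.\<close>
  have *: "dominated k (insert z (spread C B)) D"
    if z: "Inl -` {z} \<subseteq> spread G D" "base z \<in> spread G (spread G D)" for z
  proof -
    have "\<exists>x\<in>pverts H. Inr (u, x) \<notin> insert z (spread C B)" if k: "k = 0" and u: "u \<in> pverts G - D" for u
    proof -
      obtain x y where "x \<in> pverts H" "y \<in> pverts H" "x \<noteq> y" using two[OF k] by blast
      moreover then have "Inr (u, x) \<noteq> z \<or> Inr (u, y) \<noteq> z" by blast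
      ultimately show ?thesis using leaves u by blast
    qed
    moreover have "Inl -` insert z (spread C B) \<subseteq> spread G D"
      using core z(1) by blast
    moreover have "base ` insert z (spread C B) \<subseteq> spread G (spread G D)"
      using sub z(2) by simp
    ultimately show ?thesis by (simp add: dominated_def)
  qed
  show ?thesis
  proof (cases "pverts C \<subseteq> spread C B")
    case True
    have "\<exists>x\<in>pverts H. Inr (u, x) \<notin> spread C B" if "u \<in> pverts G - D" for u
      using that nonempty(2) leaves by blast
    then have "dominated k (spread C B) D"
      using core sub by (simp add: dominated_def)
    then show ?thesis using True by (auto simp: round_outcomes_def)
  next
    case False
    have "\<exists>z\<in>pverts C - spread C B. Inl -` {z} \<subseteq> spread G D \<and> base z \<in> spread G (spread G D)"
    proof (cases "spread G D = pverts G")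
      case True
      then have "spread G (spread G D) = pverts G"
        using subset_spread[of "spread G D" G] spread_subset[of "spread G D" G] by auto
      then show ?thesis using False True by (fastforce simp: corona_def)
    next
      case not_all: False
      \<comment> \<open>Connectedness forces the fire to advance, so some \<open>w\<close> is new in
        the second spread; no leaf over it burns yet.\<close>
      have "\<not> spread G (spread G D) \<subseteq> spread G D"
        using connected_spread_closed[OF G, of "spread G D"] DV not_all assms(3) subset_spread[of D G]
        by blast
      then obtain w where w: "w \<in> spread G (spread G D)" "w \<notin> spread G D" by blast
      obtain x where x: "x \<in> pverts H" using nonempty(2) by blast
      have "Inr (w, x) \<in> pverts C - spread C B"
        using w x spread_subset[OF DV] leaves[of w x] subset_spread[of D G] by auto
      then show ?thesis using w(1) by (intro bexI[of _ "Inr (w, x)"]) auto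
    qed
    then show ?thesis using * False by (auto simp: round_outcomes_def)
  qed
qed

text \<open>A Burner round and the Staller round after it cost one round of the square. For
  \<open>k = 0\<close> the bound is half the remaining rounds, rounded up; \<open>k = 1\<close>
  allows one square round more when their number is even.\<close>

lemma rounds_left_lower:
  assumes two: "k = 0 \<Longrightarrow> \<exists>x\<in>pverts H. \<exists>y\<in>pverts H. x \<noteq> y"
  shows "dominated k B D \<Longrightarrow> D \<subseteq> pverts G \<Longrightarrow>
    burnable (square G) ((rounds_left C Burner B + 1 + k) div 2) D"
proof (induction "rounds_left C Burner B" arbitrary: B D rule: less_induct)
  case less
  show ?case
  proof (cases "pverts C \<subseteq> B")
    case True
    show ?thesis
    proof (cases "k = 0")
      case True
      then have "\<forall>u\<in>pverts G - D. \<exists>x\<in>pverts H. Inr (u, x) \<notin> B"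
        using less.prems(1) by (simp add: dominated_def)
      moreover have "Inr (u, x) \<in> B" if "u \<in> pverts G" "x \<in> pverts H" for u x
        using that \<open>pverts C \<subseteq> B\<close> by (auto simp: corona_def)
      \<comment> \<open>All leaves burn, which the clause for \<open>k = 0\<close> permits only over
        \<open>D\<close>.\<close>
      ultimately have "pverts G \<subseteq> D" by blast
      then have "burnable (square G) 0 D" by simp
      then show ?thesis by (rule burnable_mono) (simp_all add: nonempty)
    next
      case False
      obtain v where v: "v \<in> pverts G" using nonempty(1) by blast
      have "Inl ` pverts G \<subseteq> B" using True by (auto simp: corona_def)
      then have "pverts G \<subseteq> spread G D"
        using less.prems(1) by (auto simp: dominated_def)
      \<comment> \<open>The core lies within one \<open>G\<close>-spread of \<open>D\<close>, so a
        single further square round with an arbitrary selection suffices; \<open>k > 0\<close> pays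
        for it.\<close>
      then have "pverts G \<subseteq> spread (square G) D"
        using subset_spread[of "spread G D" G] by (auto simp: spread_square[OF G(1) less.prems(2)])
      then have "burnable (square G) 1 D" using v by auto
      then show ?thesis by (rule burnable_mono) (use False in \<open>simp_all add: nonempty\<close>)
    qed
  next
    case False
    obtain B1 where B1: "B1 \<in> round_outcomes C B"
      "rounds_left C Burner B = Suc (rounds_left C Staller B1)"
      using rounds_left_Burner_attained[OF finite_C False] .
    obtain v where v: "v \<in> pverts G" "base ` B1 \<subseteq> insert v (spread (square G) D)"
      using dominated_Burner[OF less.prems B1(1)] by blast
    define D1 where "D1 = insert v (spread (square G) D)"
    have D1: "D1 \<subseteq> pverts G" "D1 \<noteq> {}"
      using v(1) less.prems(2) spread_subset[of D "square G"] by (auto simp: D1_def)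
    have "burnable (square G) ((rounds_left C Staller B1 + k) div 2) D1"
    proof (cases "pverts C \<subseteq> B1")
      case True
      \<comment> \<open>The game ended in Burner's round, so the projection shows that
        \<open>D1\<close> is already the whole core.\<close>
      then have "Inl ` pverts G \<subseteq> B1" by (auto simp: corona_def)
      then have "base ` (Inl ` pverts G :: ('a + 'a \<times> 'b) set) \<subseteq> D1"
        using v(2) unfolding D1_def by blast
      then have "burnable (square G) 0 D1" by (simp add: image_image)
      then show ?thesis by (rule burnable_mono) (simp_all add: nonempty)
    next
      case False
      obtain B2 where B2: "B2 \<in> round_outcomes C B1" "dominated k B2 D1"
        using dominated_Staller[OF _ D1 two] v(2) unfolding D1_def by blast
      have le: "Suc (rounds_left C Burner B2) \<le> rounds_left C Staller B1"
        by (rule rounds_left_Staller_ge[OF finite_C False B2(1)])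
      then have "burnable (square G) ((rounds_left C Burner B2 + 1 + k) div 2) D1"
        using B1(2) by (intro less.hyps B2(2) D1(1)) simp
      then show ?thesis
        by (rule burnable_mono) (use le in \<open>simp_all add: nonempty div_le_mono\<close>)
    qed
    then have "burnable (square G) (Suc ((rounds_left C Staller B1 + k) div 2)) D"
      using v(1) by (auto simp: D1_def)
    \<comment> \<open>Burner's round and the offset 1 add up to the 2 that becomes
      \<open>Suc\<close>.\<close>
    moreover have "Suc ((rounds_left C Staller B1 + k) div 2) = (rounds_left C Burner B + 1 + k) div 2"
      by (simp add: B1(2))
    ultimately show ?thesis by (simp only:)
  qed
qed

section \<open>Lower bounds from the starting positions\<close>

lemma burning_game_number_lower:
  assumes "k = 0 \<Longrightarrow> \<exists>x\<in>pverts H. \<exists>y\<in>pverts H. x \<noteq> y"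
  shows "2 * burning_number (square G) \<le> burning_game_number C + 1 + k"
proof -
  have "dominated k {} {}"
    using nonempty(2) by (auto simp: dominated_def)
  then have "burning_number (square G) \<le> (burning_game_number C + 1 + k) div 2"
    unfolding burning_game_number_def
    by (intro burning_number_le rounds_left_lower assms) auto
  then show ?thesis by linarith
qed

text \<open>Staller opens with a leaf over \<open>u\<close>, and \<open>u\<close> counts as the
  first selection in the square. This one game round stands for a whole square round, hence the
  larger constant.\<close>

lemma burning_game_number_Staller_lower:
  assumes two: "k = 0 \<Longrightarrow> \<exists>x\<in>pverts H. \<exists>y\<in>pverts H. x \<noteq> y"
  shows "2 * burning_number (square G) \<le> burning_game_number_Staller C + 2 + k"
proof -
  obtain u x where u: "u \<in> pverts G" "x \<in> pverts H" using nonempty by blast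
  have ux: "Inr (u, x) \<in> pverts C" using u by simp
  then have "pverts C \<noteq> {}" by blast
  then have B: "{Inr (u, x)} \<in> round_outcomes C {}"
    using u by (auto simp: round_outcomes_def)
  have le: "Suc (rounds_left C Burner {Inr (u, x)}) \<le> burning_game_number_Staller C"
    unfolding burning_game_number_Staller_def
    by (rule rounds_left_Staller_ge[OF finite_C _ B]) (use ux in blast)
  have "dominated k {Inr (u, x)} {u}"
    using u by (auto simp: dominated_def spread_def)
  then have "burnable (square G) ((rounds_left C Burner {Inr (u, x)} + 1 + k) div 2) {u}"
    using u by (intro rounds_left_lower two) auto
  then have "burnable (square G) (Suc ((rounds_left C Burner {Inr (u, x)} + 1 + k) div 2)) {}"
    using u by auto
  then have "burning_number (square G) \<le> Suc ((rounds_left C Burner {Inr (u, x)} + 1 + k) div 2)"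
    by (rule burning_number_le)
  then show ?thesis using le by linarith
qed

text \<open>A loopless graph on one vertex has no arcs and is thus complete; this supplies the
  hypothesis of the case \<open>k = 0\<close>.\<close>

lemma not_K1_two_vertices:
  assumes "\<not> K\<^bsub>1\<^esub> (with_proj H)"
  shows "\<exists>x\<in>pverts H. \<exists>y\<in>pverts H. x \<noteq> y"
proof (rule ccontr)
  assume *: "\<not> ?thesis"
  obtain x where "x \<in> pverts H" using nonempty(2) by blast
  with * have "pverts H = {x}" by blast
  moreover from this have "parcs H = {}"
    using H(1) by (auto simp: pair_graph_iff irrefl_def)
  ultimately show False
    using assms by (auto simp: complete_digraph_pair_def)
qed

end

theorem theorem21:
  fixes G :: "'a pair_pre_digraph" and H :: "'b pair_pre_digraph"
  assumes "pair_graph G" and "connected (with_proj G)"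
    and "pair_graph H" and "connected (with_proj H)"
  shows "2 * int (burning_number (square G)) - 2 \<le> int (burning_game_number (corona G H))
    \<and> int (burning_game_number (corona G H)) \<le> 2 * int (burning_number (square G))
    \<and> (\<not> K\<^bsub>1\<^esub> (with_proj H) \<longrightarrow>
        int (burning_game_number (corona G H)) \<noteq> 2 * int (burning_number (square G)) - 2)
    \<and> 2 * int (burning_number (square G)) - 3 \<le> int (burning_game_number_Staller (corona G H))
    \<and> int (burning_game_number_Staller (corona G H)) \<le> 2 * int (burning_number (square G)) + 1
    \<and> (\<not> K\<^bsub>1\<^esub> (with_proj H) \<longrightarrow>
        int (burning_game_number_Staller (corona G H)) \<noteq> 2 * int (burning_number (square G)) - 3)"
proof -
  interpret corona_game G H
    by (rule corona_game.intro) (fact assms)+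
  have "2 * burning_number (square G) \<le> burning_game_number C + 2"
    "2 * burning_number (square G) \<le> burning_game_number_Staller C + 3"
    using burning_game_number_lower[of 1] burning_game_number_Staller_lower[of 1] by simp_all
  moreover have "2 * burning_number (square G) \<le> burning_game_number C + 1"
    "2 * burning_number (square G) \<le> burning_game_number_Staller C + 2"
    if "\<not> K\<^bsub>1\<^esub> (with_proj H)"
    using burning_game_number_lower[of 0] burning_game_number_Staller_lower[of 0]
      not_K1_two_vertices[OF that] by simp_all
  ultimately show ?thesis
    using burning_game_number_upper burning_game_number_Staller_upper by force
qed

end
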